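(* Let $\boldsymbol{\mathcal I}\sim\mathcal H_k(m,n)$ be a random $k\mathsf{XOR}$ instance with $m=\Delta n$ clauses. If there is an efficient algorithm that with high probability certifies a bound of $\exp\big(\frac{\eta n}{10k}\big)$ on the number of $(1-\eta)$-satisfying assignments to $\boldsymbol{\mathcal I}$, then there is an efficient algorithm that with high probability certifies that $\boldsymbol{\mathcal I}$ has no $(1-\eta/2)$-satisfying assignments.
   Context: A signed $k$-uniform hypergraph on $[n]$ is a collection of pairs $(c,U)$ with $c\in\{\pm1\}^k$, $U\in[n]^k$; $\mathcal H_k(m,n)$ includes each of the $2^kn^k$ possible pairs independently with probability $\frac{m}{2^kn^k}$. As a $k\mathsf{XOR}$ instance, $x\in\{\pm1\}^n$ satisfies $(c,U)$ iff $\prod_ix_{U_i}=\prod_ic_i$, and is $(1-\eta)$-satisfying if it satisfies at least a $(1-\eta)$ fraction of clauses. An algorithm certifies a bound $C$ on a quantity $f$ with high probability if it outputs a number $A(\mathcal I)$ with $f(\mathcal I)\le A(\mathcal I)$ for every input $\mathcal I$, and $A(\boldsymbol{\mathcal I})\le C$ with probability $1-o(1)$; it certifies a statement with high probability if it always outputs success or failure, success implies the statement, and success occurs with probability $1-o(1)$. *)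

theory Defs
  imports
    "HOL-Probability.Probability"
    "HOL-Computational_Algebra.Polynomial"
    "HOL-Library.List_Lexorder"
begin

section \<open>Signed hypergraphs and kXOR instances\<close>

type_synonym clause = "int list \<times> nat list"

text \<open>An instance carries its number of variables: the pair \<open>(n, H)\<close> is a hypergraph \<open>H\<close> on
  the variables \<open>1, \<dots>, n\<close>.\<close>

type_synonym xor_instance = "nat \<times> clause set"

definition clauses :: "nat \<Rightarrow> nat \<Rightarrow> clause set" where
  "clauses k n =
     {c. length c = k \<and> set c \<subseteq> {1, -1}} \<times> {U. length U = k \<and> set U \<subseteq> {1..n}}"

definition instances :: "nat \<Rightarrow> xor_instance set" where
  "instances k = {(n, H). 1 \<le> n \<and> H \<subseteq> clauses k n}"

definition assignments :: "nat \<Rightarrow> (nat \<Rightarrow> int) set" where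
  "assignments n = {1..n} \<rightarrow>\<^sub>E {1, -1}"

fun satisfies :: "(nat \<Rightarrow> int) \<Rightarrow> clause \<Rightarrow> bool" where
  "satisfies x (c, U) \<longleftrightarrow> prod_list (map x U) = prod_list c"

text \<open>\<open>x\<close> is \<open>(1 - \<eta>)\<close>-satisfying for \<open>H\<close>. The fraction is cleared of its denominator, so that
  every assignment satisfies all clauses of the empty hypergraph.\<close>

definition approx_satisfying :: "real \<Rightarrow> clause set \<Rightarrow> (nat \<Rightarrow> int) \<Rightarrow> bool" where
  "approx_satisfying \<eta> H x \<longleftrightarrow>
     real (card {C \<in> H. satisfies x C}) \<ge> (1 - \<eta>) * real (card H)"

definition approx_satisfying_assignments :: "real \<Rightarrow> xor_instance \<Rightarrow> (nat \<Rightarrow> int) set" where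
  "approx_satisfying_assignments \<eta> = (\<lambda>(n, H). {x \<in> assignments n. approx_satisfying \<eta> H x})"

text \<open>The distribution \<open>\<H>\<^sub>k(m, n)\<close>; \<open>bernoulli_pmf\<close> truncates its parameter to \<open>[0, 1]\<close>, so
  this is meant for \<open>0 \<le> m \<le> 2\<^sup>k n\<^sup>k\<close>.\<close>

definition random_hypergraph :: "nat \<Rightarrow> real \<Rightarrow> nat \<Rightarrow> clause set pmf" where
  "random_hypergraph k m n =
     map_pmf (\<lambda>b. {C \<in> clauses k n. b C})
       (Pi_pmf (clauses k n) False (\<lambda>_. bernoulli_pmf (m / (2 ^ k * real n ^ k))))"


section \<open>Polynomial-time computation\<close>

text \<open>The machine model is a structured language for machines with finitely many stacks of
  bits (a program mentions only finitely many registers). Every elementary operation and every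
  test costs one time unit, so running times agree with those of multitape Turing machines up
  to a polynomial. \<open>Branch r\<close> distinguishes whether stack \<open>r\<close> is empty, has top bit \<open>True\<close>, or
  has top bit \<open>False\<close>; \<open>While r\<close> iterates as long as stack \<open>r\<close> is nonempty.\<close>

datatype com =
    Skip
  | Push nat bool
  | Pop nat
  | Seq com com
  | Branch nat com com com
  | While nat com

type_synonym store = "nat \<Rightarrow> bool list"

inductive exec :: "com \<Rightarrow> store \<Rightarrow> nat \<Rightarrow> store \<Rightarrow> bool" where
  Skip: "exec Skip s 1 s"
| Push: "exec (Push r b) s 1 (s(r := b # s r))"
| Pop: "exec (Pop r) s 1 (s(r := tl (s r)))"
| Seq: "exec c s t s' \<Longrightarrow> exec d s' t' s'' \<Longrightarrow> exec (Seq c d) s (t + t') s''"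
| Branch_Nil: "s r = [] \<Longrightarrow> exec c s t s' \<Longrightarrow> exec (Branch r c d e) s (Suc t) s'"
| Branch_True: "s r = True # bs \<Longrightarrow> exec d s t s' \<Longrightarrow> exec (Branch r c d e) s (Suc t) s'"
| Branch_False: "s r = False # bs \<Longrightarrow> exec e s t s' \<Longrightarrow> exec (Branch r c d e) s (Suc t) s'"
| While_Nil: "s r = [] \<Longrightarrow> exec (While r c) s 1 s"
| While_Cons: "s r \<noteq> [] \<Longrightarrow> exec c s t s' \<Longrightarrow> exec (While r c) s' t' s'' \<Longrightarrow>
    exec (While r c) s (Suc (t + t')) s''"

text \<open>\<open>f\<close> is computable in polynomial time on the inputs \<open>D\<close>, with respect to the encodings
  \<open>enc\<^sub>i\<close> of inputs and \<open>enc\<^sub>o\<close> of outputs. Input and output are on stack \<open>0\<close>.\<close>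

definition polytime_on ::
    "'a set \<Rightarrow> ('a \<Rightarrow> bool list) \<Rightarrow> ('b \<Rightarrow> bool list) \<Rightarrow> ('a \<Rightarrow> 'b) \<Rightarrow> bool" where
  "polytime_on D enc\<^sub>i enc\<^sub>o f \<longleftrightarrow>
     (\<exists>c (p :: nat poly). \<forall>x \<in> D. \<exists>t s.
        exec c ((\<lambda>_. [])(0 := enc\<^sub>i x)) t s \<and> t \<le> poly p (length (enc\<^sub>i x)) \<and> s 0 = enc\<^sub>o (f x))"


section \<open>Encodings\<close>

fun bits :: "nat \<Rightarrow> bool list" where
  "bits n = (if n = 0 then [] else odd n # bits (n div 2))"

declare bits.simps [simp del]

text \<open>Binary, least significant bit first, made self-delimiting: each bit is preceded by
  \<open>True\<close>, and \<open>False\<close> marks the end.\<close>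

definition enc_nat :: "nat \<Rightarrow> bool list" where
  "enc_nat n = concat (map (\<lambda>b. [True, b]) (bits n)) @ [False]"

definition enc_rat :: "rat \<Rightarrow> bool list" where
  "enc_rat q = (case quotient_of q of (a, b) \<Rightarrow>
     (a < 0) # enc_nat (nat \<bar>a\<bar>) @ enc_nat (nat b))"

definition enc_bool :: "bool \<Rightarrow> bool list" where
  "enc_bool b = [b]"

definition enc_clause :: "clause \<Rightarrow> bool list" where
  "enc_clause = (\<lambda>(c, U). map (\<lambda>a. a = 1) c @ concat (map enc_nat U))"

text \<open>The number of variables is written in unary, so that polynomial time means polynomial in
  the number of variables and the number of clauses. The codes of the
  clauses are listed in lexicographic order. The uniformity \<open>k\<close> is a constant known to the algorithm and is not part of the input.\<close>

definition enc_instance :: "xor_instance \<Rightarrow> bool list" where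
  "enc_instance = (\<lambda>(n, H).
     replicate n True @ [False] @ concat (sorted_list_of_set (enc_clause ` H)))"


section \<open>Certification\<close>

text \<open>In both definitions the probability is over \<open>H \<sim> \<H>\<^sub>k(m(n), n)\<close>, and \<open>n \<rightarrow> \<infinity>\<close>.\<close>

definition certifies_bound_whp ::
    "nat \<Rightarrow> (nat \<Rightarrow> real) \<Rightarrow> (xor_instance \<Rightarrow> real) \<Rightarrow> (nat \<Rightarrow> real) \<Rightarrow> (xor_instance \<Rightarrow> rat) \<Rightarrow> bool"
  where
  "certifies_bound_whp k m f C A \<longleftrightarrow>
     (\<forall>I \<in> instances k. f I \<le> of_rat (A I)) \<and>
     (\<lambda>n. measure_pmf.prob (random_hypergraph k (m n) n) {H. of_rat (A (n, H)) \<le> C n})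
       \<longlonglongrightarrow> 1"

text \<open>The output \<open>True\<close> of \<open>B\<close> stands for success, \<open>False\<close> for failure.\<close>

definition certifies_whp ::
    "nat \<Rightarrow> (nat \<Rightarrow> real) \<Rightarrow> (xor_instance \<Rightarrow> bool) \<Rightarrow> (xor_instance \<Rightarrow> bool) \<Rightarrow> bool"
  where
  "certifies_whp k m P B \<longleftrightarrow>
     (\<forall>I \<in> instances k. B I \<longrightarrow> P I) \<and>
     (\<lambda>n. measure_pmf.prob (random_hypergraph k (m n) n) {H. B (n, H)}) \<longlonglongrightarrow> 1"

end

theory Submission imports Defs begin

text \<open>Let \<open>x\<close> violate at most an \<open>\<eta>/2\<close> fraction of the clauses. By averaging, some set \<open>T\<close> of about
  \<open>\<eta>n/3k\<close> variables meets at most an \<open>\<eta>/2\<close> fraction of the clauses, so flipping \<open>x\<close> on any subset of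
  \<open>T\<close> gives \<open>2\<^bsup>\<bar>T\<bar>\<^esup> > exp (\<eta>n/10k)\<close> assignments that are \<open>(1 - \<eta>)\<close>-satisfying. Hence a certified
  bound below \<open>2\<^bsup>\<bar>T\<bar>\<^esup>\<close> refutes the existence of \<open>x\<close>. Since \<open>\<eta>\<close> may be an uncomputable real, the
  certified bound \<open>a/b\<close> is not compared with \<open>exp (\<eta>n/10k)\<close>: it suffices to compare the difference
  of the bit lengths of \<open>a\<close> and \<open>b\<close> with \<open>n/M\<close> for the integer constant \<open>M = \<lceil>3k/\<eta>\<rceil>\<close>.\<close>

section \<open>Flipping variables of low degree\<close>

text \<open>Induction on the number of discarded elements, always dropping an element
  \<open>a\<close> of largest \<open>d\<close>. Every element of the chosen \<open>T\<close> then
  has weight at most \<open>d a\<close>, so \<open>sum d T \<le> t * d a\<close>, which is exactly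
  what passing from \<open>B\<close> back to \<open>A\<close> adds to the two sides.\<close>

lemma ex_subset_sum_le_average:
  fixes d :: "'a \<Rightarrow> nat"
  assumes "finite A" "t \<le> card A"
  shows "\<exists>T \<subseteq> A. card T = t \<and> card A * sum d T \<le> t * sum d A"
  using assms
proof (induction "card A - t" arbitrary: A)
  case 0
  then show ?case by (intro exI[of _ A]) auto
next
  case (Suc m)
  then have "A \<noteq> {}" by auto
  then have "Max (d ` A) \<in> d ` A" using Suc.prems(1) by (intro Max_in) auto
  then obtain a where a: "a \<in> A" "Max (d ` A) = d a" by blast
  have max: "d b \<le> d a" if "b \<in> A" for b
    using Max_ge[of "d ` A" "d b"] a(2) that Suc.prems(1) by simp
  define B where "B = A - {a}"
  have A: "finite B" "a \<notin> B" "card A = Suc (card B)" "sum d A = d a + sum d B"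
    using Suc.prems(1) a(1) by (auto simp: B_def card.remove sum.remove simp del: card_Diff_insert)
  then obtain T where T: "T \<subseteq> B" "card T = t" "card B * sum d T \<le> t * sum d B"
    using Suc.hyps(1)[of B] Suc.hyps(2) by fastforce
  have "sum d T \<le> t * d a"
    using sum_bounded_above[of T d "d a"] T(1,2) max by (auto simp: B_def)
  then have "card A * sum d T \<le> t * sum d A"
    using T(3) A(3,4) by (simp add: algebra_simps)
  then show ?case using T(1,2) by (auto simp: B_def)
qed

lemma finite_clauses: "finite (clauses k n)"
proof -
  have "finite {c :: int list. length c = k \<and> set c \<subseteq> {1, -1}}"
    using finite_lists_length_eq[of "{1, -1 :: int}" k] by (simp add: conj_commute)
  moreover have "finite {U. length U = k \<and> set U \<subseteq> {1..n}}"
    using finite_lists_length_eq[of "{1..n}" k] by (simp add: conj_commute)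
  ultimately show ?thesis by (simp add: clauses_def)
qed

text \<open>Double counting of incidences: a clause has \<open>k\<close> positions, hence at most
  \<open>k\<close> distinct variables. Only an inequality results, since variables may
  repeat.\<close>

lemma sum_degrees_le:
  assumes "H \<subseteq> clauses k n"
  shows "(\<Sum>i\<in>{1..n}. card {C \<in> H. i \<in> set (snd C)}) \<le> k * card H"
proof -
  have fin: "finite H" using assms finite_clauses finite_subset by blast
  have "(\<Sum>i\<in>{1..n}. card {C \<in> H. i \<in> set (snd C)}) =
      (\<Sum>i\<in>{1..n}. \<Sum>C\<in>H. if i \<in> set (snd C) then 1 else 0)"
    using fin by (simp add: sum.If_cases Int_def)
  also have "\<dots> = (\<Sum>C\<in>H. \<Sum>i\<in>{1..n}. if i \<in> set (snd C) then 1 else 0)"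
    by (rule sum.swap)
  also have "\<dots> = (\<Sum>C\<in>H. card ({1..n} \<inter> set (snd C)))"
    by (simp add: sum.If_cases)
  also have "\<dots> \<le> (\<Sum>C\<in>H. k)"
  proof (rule sum_mono)
    fix C assume "C \<in> H"
    then have "length (snd C) = k" using assms by (auto simp: clauses_def)
    then show "card ({1..n} \<inter> set (snd C)) \<le> k"
      by (metis card_length card_mono finite_set inf_le2 le_trans)
  qed
  finally show ?thesis by (simp add: mult.commute)
qed

text \<open>The restriction to \<open>{1..n}\<close> keeps the result extensional, as membership in
  \<open>assignments n\<close> demands.\<close>

definition flip :: "nat \<Rightarrow> (nat \<Rightarrow> int) \<Rightarrow> nat set \<Rightarrow> nat \<Rightarrow> int" where
  "flip n x S = (\<lambda>i\<in>{1..n}. if i \<in> S then - x i else x i)"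

lemma flip_in_assignments: "x \<in> assignments n \<Longrightarrow> flip n x S \<in> assignments n"
  by (fastforce simp: assignments_def flip_def PiE_iff)

text \<open>The values of \<open>x\<close> are nonzero, so \<open>- x i\<close> differs from
  \<open>x i\<close> and the set \<open>S\<close> can be read off from the flipped
  assignment.\<close>

lemma inj_on_flip:
  assumes "x \<in> assignments n"
  shows "inj_on (flip n x) (Pow {1..n})"
proof (rule inj_onI)
  fix S S' assume S: "S \<in> Pow {1..n}" "S' \<in> Pow {1..n}" and eq: "flip n x S = flip n x S'"
  have "i \<in> S \<longleftrightarrow> i \<in> S'" if "i \<in> {1..n}" for i
  proof -
    have "x i \<in> {1, -1}" using assms that unfolding assignments_def by (rule PiE_mem)
    then show ?thesis
      using fun_cong[OF eq, of i] that by (auto simp: flip_def split: if_splits)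
  qed
  then show "S = S'" using S by auto
qed

lemma satisfies_flip:
  assumes "(c, U) \<in> clauses k n" "set U \<inter> S = {}"
  shows "satisfies (flip n x S) (c, U) \<longleftrightarrow> satisfies x (c, U)"
proof -
  have "map (flip n x S) U = map x U"
    using assms by (auto simp: flip_def clauses_def)
  then show ?thesis by (simp only: satisfies.simps)
qed

text \<open>A satisfied clause can be lost only if it contains a variable of \<open>S\<close>, hence
  of \<open>T\<close>. A union bound counts such clauses by the degrees in \<open>T\<close>.\<close>

lemma approx_satisfying_flip:
  fixes \<delta> \<epsilon> :: real
  assumes H: "H \<subseteq> clauses k n" and x: "approx_satisfying \<delta> H x" and "S \<subseteq> T" "finite T"
    and T: "real (\<Sum>i\<in>T. card {C \<in> H. i \<in> set (snd C)}) \<le> \<epsilon> * card H"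
  shows "approx_satisfying (\<delta> + \<epsilon>) H (flip n x S)"
proof -
  have fin: "finite H" using H finite_clauses finite_subset by blast
  let ?D = "\<Union>i\<in>T. {C \<in> H. i \<in> set (snd C)}"
  have "{C \<in> H. satisfies x C} \<subseteq> {C \<in> H. satisfies (flip n x S) C} \<union> ?D"
  proof
    fix C assume C: "C \<in> {C \<in> H. satisfies x C}"
    obtain c U where [simp]: "C = (c, U)" by (cases C)
    show "C \<in> {C \<in> H. satisfies (flip n x S) C} \<union> ?D"
    proof (cases "set U \<inter> S = {}")
      case True
      then show ?thesis using C H satisfies_flip[of c U k n S x] by auto
    next
      case False
      then show ?thesis using C \<open>S \<subseteq> T\<close> by auto
    qed
  qed
  then have "card {C \<in> H. satisfies x C} \<le> card ({C \<in> H. satisfies (flip n x S) C} \<union> ?D)"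
    using fin \<open>finite T\<close> by (intro card_mono) auto
  also have "\<dots> \<le> card {C \<in> H. satisfies (flip n x S) C} + card ?D"
    by (rule card_Un_le)
  also have "card ?D \<le> (\<Sum>i\<in>T. card {C \<in> H. i \<in> set (snd C)})"
    using \<open>finite T\<close> by (rule card_UN_le)
  finally have "real (card {C \<in> H. satisfies x C}) \<le>
      card {C \<in> H. satisfies (flip n x S) C} + (\<Sum>i\<in>T. card {C \<in> H. i \<in> set (snd C)})"
    by linarith
  then show ?thesis using x T by (simp add: approx_satisfying_def algebra_simps)
qed

lemma card_approx_satisfying_assignments_ge:
  assumes I: "(n, H) \<in> instances k" and "1 \<le> k" "\<eta> \<le> 1"
    and ne: "approx_satisfying_assignments (\<eta> / 2) (n, H) \<noteq> {}"
    and t: "2 * real k * real t \<le> \<eta> * real n"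
  shows "2 ^ t \<le> card (approx_satisfying_assignments \<eta> (n, H))"
proof -
  let ?d = "\<lambda>i. card {C \<in> H. i \<in> set (snd C)}"
  from I have n: "1 \<le> n" and H: "H \<subseteq> clauses k n" by (auto simp: instances_def)
  from ne obtain x where x: "x \<in> assignments n" "approx_satisfying (\<eta> / 2) H x"
    by (auto simp: approx_satisfying_assignments_def)
  \<comment> \<open>There must be at least \<open>t\<close> variables for \<open>T\<close> to exist;
    this is where \<open>\<eta> \<le> 1\<close> enters.\<close>
  have "real t \<le> 2 * real k * real t"
    using \<open>1 \<le> k\<close> mult_right_mono[of 1 "2 * real k" "real t"] by simp
  also have "\<dots> \<le> 1 * real n"
    using t \<open>\<eta> \<le> 1\<close> mult_right_mono[of \<eta> 1 "real n"] by linarith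
  finally have "t \<le> card {1..n}" by simp
  then obtain T where T: "T \<subseteq> {1..n}" "card T = t" "card {1..n} * sum ?d T \<le> t * sum ?d {1..n}"
    using ex_subset_sum_le_average[of "{1..n}" t ?d] by auto
  have finT: "finite T" using T(1) finite_subset by blast
  have "n * sum ?d T \<le> t * (k * card H)"
    using T(3) mult_le_mono2[OF sum_degrees_le[OF H], of t] by (simp only: card_atLeastAtMost diff_Suc_1)
  then have "real (n * sum ?d T) \<le> real (t * (k * card H))"
    by (rule of_nat_mono)
  then have "real n * real (sum ?d T) \<le> real t * (real k * real (card H))"
    by (simp only: of_nat_mult)
  \<comment> \<open>The factor 2 in the hypothesis on \<open>t\<close> makes the loss
    \<open>\<eta> / 2\<close>, which together with the violation \<open>\<eta> / 2\<close> of
    \<open>x\<close> exhausts \<open>\<eta>\<close>.\<close>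
  also have "\<dots> = (2 * real k * real t) * real (card H) / 2" by simp
  also have "\<dots> \<le> (\<eta> * real n) * real (card H) / 2"
    using t by (intro divide_right_mono mult_right_mono) auto
  finally have "real n * real (sum ?d T) \<le> real n * (\<eta> / 2 * real (card H))"
    by (simp add: algebra_simps)
  then have dT: "real (sum ?d T) \<le> \<eta> / 2 * real (card H)"
    using n by simp
  have "flip n x ` Pow T \<subseteq> approx_satisfying_assignments \<eta> (n, H)"
    using flip_in_assignments[OF x(1)] approx_satisfying_flip[OF H x(2) _ finT dT]
    by (auto simp: approx_satisfying_assignments_def)
  moreover have "finite (approx_satisfying_assignments \<eta> (n, H))"
    by (rule finite_subset[of _ "assignments n"])
      (auto simp: approx_satisfying_assignments_def assignments_def intro: finite_PiE)
  ultimately have "card (flip n x ` Pow T) \<le> card (approx_satisfying_assignments \<eta> (n, H))"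
    by (rule card_mono[rotated])
  moreover have "inj_on (flip n x) (Pow T)"
    using T(1) by (intro inj_on_subset[OF inj_on_flip[OF x(1)]]) auto
  then have "card (flip n x ` Pow T) = 2 ^ t"
    using T(2) finT by (simp add: card_image card_Pow)
  ultimately show ?thesis by simp
qed


section \<open>Bit lengths\<close>

lemma less_two_power_length_bits: "n < 2 ^ length (bits n)"
proof (induction n rule: bits.induct)
  case (1 n)
  then show ?case by (subst bits.simps) auto
qed

lemma two_power_length_bits_le: "n \<noteq> 0 \<Longrightarrow> 2 ^ length (bits n) \<le> 2 * n"
proof (induction n rule: bits.induct)
  case (1 n)
  show ?case
  proof (cases "n = 1")
    case True
    then show ?thesis by (simp add: bits.simps)
  next
    case False
    with 1 have "2 ^ length (bits (n div 2)) \<le> 2 * (n div 2)" by auto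
    then show ?thesis using 1(2) by (subst bits.simps) auto
  qed
qed

text \<open>For \<open>q \<ge> 0\<close> and \<open>j \<ge> 1\<close> this holds if \<open>q \<le> 2\<^bsup>j-2\<^esup>\<close> and fails if \<open>q \<ge> 2\<^bsup>j-1\<^esup>\<close>;
  the sign of \<open>q\<close> is ignored.\<close>

definition small_rat :: "nat \<Rightarrow> rat \<Rightarrow> bool" where
  "small_rat j q \<longleftrightarrow> (case quotient_of q of (a, b) \<Rightarrow>
     length (bits (nat \<bar>a\<bar>)) + 2 \<le> length (bits (nat b)) + j)"

lemma real_of_rat_quotient:
  assumes "quotient_of q = (a, b)"
  shows "real_of_rat q = real_of_int a / real_of_int b" "0 < b"
  using quotient_of_div[OF assms] quotient_of_denom_pos[OF assms]
  by (simp_all add: of_rat_divide)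

text \<open>Bit lengths locate numerator and denominator up to a factor 2 each:
  \<open>a < 2 ^ ?la\<close> and \<open>2 ^ ?lb \<le> 2 * b\<close>, hence a / b lies below 2 to the
  power ?la - ?lb + 1.\<close>

lemma small_rat_imp_less:
  assumes "small_rat (Suc j) q" "0 \<le> q"
  shows "real_of_rat q < 2 ^ j"
proof -
  obtain a b where ab: "quotient_of q = (a, b)" by fastforce
  note q = real_of_rat_quotient[OF ab]
  let ?la = "length (bits (nat \<bar>a\<bar>))" and ?lb = "length (bits (nat b))"
  have le: "?la + 1 \<le> ?lb + j" using assms(1) ab by (simp add: small_rat_def)
  have "nat \<bar>a\<bar> < 2 ^ ?la" by (rule less_two_power_length_bits)
  then have "real (nat \<bar>a\<bar>) < 2 ^ ?la" by (metis of_nat_less_numeral_power_cancel_iff)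
  moreover have "real_of_int a \<le> real (nat \<bar>a\<bar>)" by simp
  ultimately have "real_of_int a < 2 ^ ?la" by (rule le_less_trans[rotated])
  then have "2 * real_of_int a < 2 ^ (?la + 1)" by simp
  also have "\<dots> \<le> 2 ^ (?lb + j)" using le by (intro power_increasing) auto
  also have "\<dots> = 2 ^ ?lb * 2 ^ j" by (simp add: power_add)
  also have "\<dots> \<le> 2 * real_of_int b * 2 ^ j"
  proof (intro mult_right_mono)
    have "2 ^ ?lb \<le> 2 * nat b" using q(2) by (intro two_power_length_bits_le) auto
    then have "real (2 ^ ?lb) \<le> real (2 * nat b)" using of_nat_le_iff by blast
    then show "2 ^ ?lb \<le> 2 * real_of_int b" using q(2) by simp
  qed simp
  finally show ?thesis unfolding q(1) using q(2) by (simp add: field_simps)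
qed

text \<open>Here the opposite estimates \<open>b < 2 ^ ?lb\<close> and
  \<open>2 ^ ?la \<le> 2 * a\<close> are combined; one factor 2 is rounding of \<open>a\<close>, the
  other comes from the offset in \<open>small_rat\<close>.\<close>

lemma not_small_rat_imp_less:
  assumes "\<not> small_rat j q" "0 \<le> q" "1 \<le> j"
  shows "2 ^ j < 4 * real_of_rat q"
proof -
  obtain a b where ab: "quotient_of q = (a, b)" by fastforce
  note q = real_of_rat_quotient[OF ab]
  let ?la = "length (bits (nat \<bar>a\<bar>))" and ?lb = "length (bits (nat b))"
  have le: "?lb + j \<le> ?la + 1" using assms(1) ab by (simp add: small_rat_def)
  have "0 \<le> real_of_int a / real_of_int b" using assms(2) q(1) by (metis zero_le_of_rat_iff)
  then have a0: "0 \<le> a" using q(2) by (auto simp: zero_le_divide_iff)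
  have "bits (nat b) \<noteq> []" using q(2) by (subst bits.simps) auto
  show ?thesis
  proof (cases "a = 0")
    \<comment> \<open>Zero has no bits, while the positive denominator has at least one, so with
      \<open>j \<ge> 1\<close> the test could not have failed.\<close>
    case True
    then have "?la = 0" by (simp add: bits.simps)
    then have "?lb + j \<le> 1" using le by linarith
    moreover have "?lb \<ge> 1" using \<open>bits (nat b) \<noteq> []\<close> by (cases "bits (nat b)") auto
    ultimately show ?thesis using assms(3) by linarith
  next
    case False
    have "real_of_int b * 2 ^ j < 2 ^ ?lb * 2 ^ j"
    proof (intro mult_strict_right_mono)
      have "nat b < 2 ^ ?lb" by (rule less_two_power_length_bits)
      then have "real (nat b) < 2 ^ ?lb" by (metis of_nat_less_numeral_power_cancel_iff)
      then show "real_of_int b < 2 ^ ?lb" using q(2) by simp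
    qed simp
    also have "\<dots> = 2 ^ (?lb + j)" by (simp add: power_add)
    also have "\<dots> \<le> 2 ^ (?la + 1)" using le by (intro power_increasing) auto
    also have "\<dots> \<le> 4 * real_of_int a"
    proof -
      have "2 ^ ?la \<le> 2 * nat \<bar>a\<bar>" using False by (intro two_power_length_bits_le) auto
      then have "real (2 ^ ?la) \<le> real (2 * nat \<bar>a\<bar>)" using of_nat_le_iff by blast
      then show ?thesis using a0 by simp
    qed
    finally show ?thesis unfolding q(1) using q(2) by (simp add: field_simps)
  qed
qed


section \<open>Machine programs\<close>

fun regs :: "com \<Rightarrow> nat set" where
  "regs Skip = {}"
| "regs (Push r b) = {r}"
| "regs (Pop r) = {r}"
| "regs (Seq c d) = regs c \<union> regs d"
| "regs (Branch r c d e) = insert r (regs c \<union> regs d \<union> regs e)"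
| "regs (While r c) = insert r (regs c)"

lemma finite_regs: "finite (regs c)"
  by (induction c) auto

text \<open>A program neither reads nor writes registers it does not mention, so the given program
  for \<open>A\<close> can run while higher registers keep other data.\<close>

lemma exec_frame:
  "exec c s t s' \<Longrightarrow> regs c \<subseteq> R \<Longrightarrow> exec c (override_on u s R) t (override_on u s' R)"
proof (induction rule: exec.induct)
  case (Push r b s)
  then have "override_on u (s(r := b # s r)) R =
      (override_on u s R)(r := b # override_on u s R r)"
    by (auto simp: override_on_def)
  then show ?case by (simp only: exec.Push)
next
  case (Pop r s)
  then have "override_on u (s(r := tl (s r))) R =
      (override_on u s R)(r := tl (override_on u s R r))"
    by (auto simp: override_on_def)
  then show ?case by (simp only: exec.Pop)
next
  case (Skip s)
  show ?case by (rule exec.Skip)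
next
  case (While_Nil s r c)
  then show ?case by (intro exec.While_Nil) auto
qed (auto intro: exec.intros(4-7,9))

text \<open>One time unit pushes at most one bit. This bounds the length of the output of
  \<open>A\<close>, and with it the cost of examining that output.\<close>

lemma length_exec_le: "exec c s t s' \<Longrightarrow> length (s' r) \<le> length (s r) + t"
  by (induction rule: exec.induct) auto

text \<open>Abstracts from \<open>Push\<close> and \<open>Pop\<close>, so that the same loops serve
  to count up and to count down.\<close>

definition updates :: "com \<Rightarrow> nat \<Rightarrow> (bool list \<Rightarrow> bool list) \<Rightarrow> bool" where
  "updates c r g \<longleftrightarrow> (\<forall>s. exec c s 1 (s(r := g (s r))))"

lemma updates_Push: "updates (Push r b) r ((#) b)"
  by (simp add: updates_def exec.Push[simplified])

lemma updates_Pop: "updates (Pop r) r tl"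
  by (simp add: updates_def exec.Pop[simplified])

section \<open>Rounded-up division of a stack length by a constant\<close>

fun pops :: "nat \<Rightarrow> nat \<Rightarrow> com" where
  "pops r 0 = Skip"
| "pops r (Suc n) = Seq (Pop r) (pops r n)"

lemma exec_pops: "exec (pops r n) s (Suc n) (s(r := drop n (s r)))"
proof (induction n arbitrary: s)
  case 0
  then show ?case using exec.Skip by simp
next
  case (Suc n)
  from exec.Seq[OF exec.Pop[of r s] Suc[of "s(r := tl (s r))"]] show ?case
    by (simp add: drop_Suc fun_upd_upd del: fun_upd_apply) (simp add: fun_upd_same)
qed

text \<open>The quotient is l / m rounded up. Truncated subtraction mirrors the machine: a last
  round with fewer than \<open>m\<close> entries pops an already empty stack and still
  counts.\<close>

lemma ceil_div_rec:
  fixes l m :: nat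
  assumes "1 \<le> m" "0 < l"
  shows "(l + m - 1) div m = Suc ((l - m + m - 1) div m)"
proof -
  have "l + m - 1 = (l - 1) + m" using assms(2) by simp
  moreover have "((l - 1) + m) div m = Suc ((l - 1) div m)" using assms(1) by simp
  ultimately have "(l + m - 1) div m = Suc ((l - 1) div m)" by (simp only:)
  also have "(l - 1) div m = (l - m + m - 1) div m"
  proof (cases "m \<le> l")
    case False
    then have "(l - 1) div m = 0" by (intro div_less) simp
    moreover have "l - m + m - 1 = m - 1" using False by simp
    moreover have "(m - 1) div m = 0" using assms(1) by (intro div_less) simp
    ultimately show ?thesis by (simp only:)
  qed simp
  finally show ?thesis .
qed

definition drain :: "nat \<Rightarrow> nat \<Rightarrow> com \<Rightarrow> com" where
  "drain r m c = While r (Seq (pops r m) c)"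

text \<open>A round costs \<open>m + 1\<close> for the pops, 1 for \<open>c\<close> and 1 for the
  loop test; the outer \<open>Suc\<close> is the final failing test. With \<open>m = 1\<close> this
  is a plain transfer or subtraction.\<close>

lemma exec_drain:
  assumes "updates c p g" "r \<noteq> p" "1 \<le> m"
  defines "j \<equiv> \<lambda>l. (l + m - 1) div m"
  shows "exec (drain r m c) s (Suc (j (length (s r)) * (m + 3)))
    (s(r := [], p := (g ^^ j (length (s r))) (s p)))"
proof (induction "length (s r)" arbitrary: s rule: less_induct)
  case less
  show ?case
  proof (cases "s r = []")
    case True
    then have "j (length (s r)) = 0" using assms(3) by (simp add: j_def)
    moreover have "s(r := []) = s" using True by auto
    ultimately show ?thesis using exec.While_Nil[of s r, OF True] by (simp add: drain_def)
  next
    case False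
    let ?s = "s(r := drop m (s r), p := g (s p))"
    have body: "exec (Seq (pops r m) c) s (Suc m + 1) ?s"
      using assms(1)[unfolded updates_def, rule_format, of "s(r := drop m (s r))"] assms(2)
      by (intro exec.Seq[OF exec_pops]) auto
    have "length (?s r) < length (s r)" using False assms by simp
    note IH = less[of ?s, OF this]
    have j: "j (length (s r)) = Suc (j (length (s r) - m))"
      unfolding j_def using False assms(3) by (intro ceil_div_rec) auto
    have "(g ^^ j (length (s r) - m)) (g (s p)) = (g ^^ j (length (s r))) (s p)"
      by (simp add: j funpow_Suc_right del: funpow.simps)
    then have "?s(r := [], p := (g ^^ j (length (s r) - m)) (?s p)) =
        s(r := [], p := (g ^^ j (length (s r))) (s p))"
      by (simp add: fun_upd_twist[OF assms(2)])
    moreover have "Suc (Suc m + 1 + Suc (j (length (s r) - m) * (m + 3))) =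
        Suc (j (length (s r)) * (m + 3))"
      by (simp add: j)
    moreover have "exec (While r (Seq (pops r m) c)) s
        (Suc (Suc m + 1 + Suc (j (length (s r) - m) * (m + 3))))
        (?s(r := [], p := (g ^^ j (length (s r) - m)) (?s p)))"
      using exec.While_Cons[OF False body IH[unfolded drain_def]] assms(2) by simp
    ultimately show ?thesis by (simp only: drain_def)
  qed
qed

section \<open>Reading unary and self-delimiting binary numbers\<close>

definition copy_unary :: "nat \<Rightarrow> nat \<Rightarrow> nat \<Rightarrow> com" where
  "copy_unary f a b =
     Seq (Push f True) (While f (Branch 0 (Pop f)
       (Seq (Pop 0) (Seq (Push a True) (Push b True))) (Pop f)))"

text \<open>\<open>While\<close> tests only for emptiness, and stack 0 need not be empty after the
  unary block. Hence the flag \<open>f\<close> drives the loop and is popped at the delimiter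
  \<open>False\<close>, which stays in place.\<close>

lemma exec_copy_unary:
  assumes "s 0 = replicate n True @ False # w" "s f = []" "distinct [0, f, a, b]"
  shows "exec (copy_unary f a b) s (5 * n + 5)
    (s(0 := False # w, a := replicate n True @ s a, b := replicate n True @ s b))"
proof -
  let ?W = "While f (Branch 0 (Pop f) (Seq (Pop 0) (Seq (Push a True) (Push b True))) (Pop f))"
  have loop: "exec ?W s (5 * n + 4)
    (s(0 := False # w, f := [], a := replicate n True @ s a, b := replicate n True @ s b))"
    if "s 0 = replicate n True @ False # w" "s f = [True]" for s
    using that
  proof (induction n arbitrary: s)
    case 0
    have "exec (Branch 0 (Pop f) (Seq (Pop 0) (Seq (Push a True) (Push b True))) (Pop f)) s
        (Suc 1) (s(f := tl (s f)))"
      using 0 by (intro exec.Branch_False[where bs = w] exec.Pop) auto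
    from exec.While_Cons[OF _ this exec.While_Nil] 0
    have "exec ?W s 4 (s(f := tl (s f)))" by (simp add: numeral_eq_Suc)
    moreover have "s(f := tl (s f)) =
        s(0 := False # w, f := [], a := replicate 0 True @ s a, b := replicate 0 True @ s b)"
      using 0 assms(3) by auto
    ultimately show ?case by (simp only: mult_0_right add_0)
  next
    case (Suc n)
    let ?s = "s(0 := replicate n True @ False # w, a := True # s a, b := True # s b)"
    have "exec (Seq (Pop 0) (Seq (Push a True) (Push b True))) s (1 + (1 + 1)) 
      (s(0 := tl (s 0), a := True # (s(0 := tl (s 0))) a,
         b := True # (s(0 := tl (s 0), a := True # (s(0 := tl (s 0))) a)) b))"
      by (rule exec.Seq[OF exec.Pop exec.Seq[OF exec.Push exec.Push]])
    then have "exec (Seq (Pop 0) (Seq (Push a True) (Push b True))) s 3 ?s"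
      using Suc.prems assms(3) by (simp add: numeral_eq_Suc)
    then have body: "exec (Branch 0 (Pop f) (Seq (Pop 0) (Seq (Push a True) (Push b True))) (Pop f)) s
        (Suc 3) ?s"
      using Suc.prems by (intro exec.Branch_True[where bs = "replicate n True @ False # w"]) auto
    have "exec ?W ?s (5 * n + 4) (?s(0 := False # w, f := [], a := replicate n True @ ?s a,
        b := replicate n True @ ?s b))"
      using Suc.prems assms(3) by (intro Suc.IH) auto
    from exec.While_Cons[OF _ body this] Suc.prems
    have "exec ?W s (5 * Suc n + 4) (?s(0 := False # w, f := [], a := replicate n True @ ?s a,
        b := replicate n True @ ?s b))"
      by simp
    moreover have "?s(0 := False # w, f := [], a := replicate n True @ ?s a,
        b := replicate n True @ ?s b) = s(0 := False # w, f := [],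
        a := replicate (Suc n) True @ s a, b := replicate (Suc n) True @ s b)"
      using assms(3) by (auto simp: replicate_app_Cons_same)
    ultimately show ?case by (simp only:)
  qed
  have "exec ?W (s(f := True # s f)) (5 * n + 4)
    (s(0 := False # w, a := replicate n True @ s a, b := replicate n True @ s b))"
  proof -
    have "(s(f := True # s f))(0 := False # w, f := [], a := replicate n True @ (s(f := True # s f)) a,
        b := replicate n True @ (s(f := True # s f)) b) =
      s(0 := False # w, a := replicate n True @ s a, b := replicate n True @ s b)"
      using assms by auto
    then show ?thesis using loop[of "s(f := True # s f)"] assms by simp
  qed
  from exec.Seq[OF exec.Push this] show ?thesis by (simp add: copy_unary_def add.commute)
qed

text \<open>Runs \<open>c\<close> once per binary digit and discards the digit itself, since only
  bit lengths matter. The end marker is consumed, so a following code can be read next.\<close>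

definition parse_nat :: "nat \<Rightarrow> com \<Rightarrow> com" where
  "parse_nat f c =
     Seq (Push f True) (While f (Branch 0 (Pop f)
       (Seq (Pop 0) (Seq (Pop 0) c)) (Seq (Pop 0) (Pop f))))"

lemma exec_parse_nat:
  assumes "updates c p g" "s 0 = enc_nat n @ w" "s f = []" "distinct [0, f, p]"
  shows "exec (parse_nat f c) s (5 * length (bits n) + 6)
    (s(0 := w, p := (g ^^ length (bits n)) (s p)))"
proof -
  let ?B = "Branch 0 (Pop f) (Seq (Pop 0) (Seq (Pop 0) c)) (Seq (Pop 0) (Pop f))"
  have loop: "exec (While f ?B) s (5 * length l + 5)
    (s(0 := w, f := [], p := (g ^^ length l) (s p)))"
    if "s 0 = concat (map (\<lambda>b. [True, b]) l) @ False # w" "s f = [True]" for s l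
    using that
  proof (induction l arbitrary: s)
    case Nil
    have "exec ?B s (Suc (1 + 1)) (s(0 := tl (s 0), f := tl ((s(0 := tl (s 0))) f)))"
      using Nil by (intro exec.Branch_False[where bs = w, OF _ exec.Seq[OF exec.Pop exec.Pop]]) simp
    from exec.While_Cons[OF _ this exec.While_Nil] Nil assms(4)
    have "exec (While f ?B) s 5 (s(0 := w, f := []))" by (simp add: numeral_eq_Suc)
    moreover have "s(0 := w, f := []) = s(0 := w, f := [], p := (g ^^ length ([] :: bool list)) (s p))"
      using assms(4) by auto
    ultimately show ?case by (simp only: list.size mult_0_right add_0)
  next
    case (Cons b l)
    let ?w = "concat (map (\<lambda>b. [True, b]) l) @ False # w"
    let ?s = "s(0 := ?w, p := g (s p))"
    have c: "exec c u 1 (u(p := g (u p)))" for u using assms(1) by (simp add: updates_def)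
    have "exec (Seq (Pop 0) (Seq (Pop 0) c)) s (1 + (1 + 1))
      (s(0 := tl (s 0), 0 := tl ((s(0 := tl (s 0))) 0),
         p := g ((s(0 := tl (s 0), 0 := tl ((s(0 := tl (s 0))) 0))) p)))"
      by (rule exec.Seq[OF exec.Pop exec.Seq[OF exec.Pop c]])
    then have "exec (Seq (Pop 0) (Seq (Pop 0) c)) s 3 ?s"
      using Cons.prems assms(4) by (simp add: numeral_eq_Suc)
    then have body: "exec ?B s (Suc 3) ?s"
      using Cons.prems by (intro exec.Branch_True[where bs = "b # ?w"]) auto
    have "exec (While f ?B) ?s (5 * length l + 5)
        (?s(0 := w, f := [], p := (g ^^ length l) (?s p)))"
      using Cons.prems assms(4) by (intro Cons.IH) auto
    from exec.While_Cons[OF _ body this] Cons.prems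
    have "exec (While f ?B) s (5 * length (b # l) + 5)
        (?s(0 := w, f := [], p := (g ^^ length l) (?s p)))"
      by simp
    moreover have "?s(0 := w, f := [], p := (g ^^ length l) (?s p)) =
        s(0 := w, f := [], p := (g ^^ length (b # l)) (s p))"
      using assms(4) by (auto simp: funpow_swap1)
    ultimately show ?case by (simp only:)
  qed
  have "exec (While f ?B) (s(f := True # s f)) (5 * length (bits n) + 5)
    (s(0 := w, p := (g ^^ length (bits n)) (s p)))"
  proof -
    have "(s(f := True # s f))(0 := w, f := [], p := (g ^^ length (bits n)) ((s(f := True # s f)) p)) =
      s(0 := w, p := (g ^^ length (bits n)) (s p))"
      using assms(3,4) by auto
    then show ?thesis using loop[of "s(f := True # s f)" "bits n"] assms(2-4)
      by (simp add: enc_nat_def)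
  qed
  from exec.Seq[OF exec.Push this] show ?thesis by (simp add: parse_nat_def add.commute)
qed

section \<open>The program wrapped around the one for \<open>A\<close>\<close>

lemma funpow_Cons: "((#) b ^^ n) l = replicate n b @ l"
  by (induction n) auto

lemma funpow_tl: "(tl ^^ n) l = drop n l"
  by (induction n arbitrary: l) (auto simp: funpow_swap1 drop_Suc tl_drop)

lemma ceil_div_le:
  fixes n M :: nat
  assumes "1 \<le> M"
  shows "(n + M - 1) div M \<le> n"
proof (cases n)
  case (Suc i)
  have "i + M \<le> i * M + M" using assms by simp
  then have "(i + M) div M \<le> (Suc i * M) div M" by (intro div_le_mono) simp
  then show ?thesis using Suc assms by simp
qed (use assms in simp)

text \<open>The registers \<open>N\<close> (loop flag), \<open>N + 1\<close> and \<open>N + 2\<close> (copies of the unary \<open>n\<close>), \<open>N + 3\<close> (\<open>n/M\<close>,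
  rounded up, in unary) and \<open>N + 4\<close> (difference of bit lengths) lie above those of the program for \<open>A\<close>.\<close>

definition count_vars :: "nat \<Rightarrow> nat \<Rightarrow> com" where
  "count_vars N M = Seq (copy_unary N (N + 1) (N + 2))
     (Seq (drain (N + 1) 1 (Push 0 True)) (drain (N + 2) M (Push (N + 3) True)))"

text \<open>Reading the unary block destroys it, hence two copies: one is pushed back to restore the
  input for \<open>A\<close>, the other is divided by \<open>M\<close>.\<close>

lemma exec_count_vars:
  assumes "0 < N" "1 \<le> M" and s_def: "s = (\<lambda>_. [])(0 := replicate n True @ False # w)"
  shows "\<exists>t \<le> 12 * n + 4 * M * n + 20. exec (count_vars N M) s t
    (s(N + 3 := replicate ((n + M - 1) div M) True))"
proof -
  let ?s1 = "s(0 := False # w, N + 1 := replicate n True @ s (N + 1), N + 2 := replicate n True @ s (N + 2))"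
  have 1: "exec (copy_unary N (N + 1) (N + 2)) s (5 * n + 5) ?s1"
    using assms by (intro exec_copy_unary) auto
  have 2: "exec (drain (N + 1) 1 (Push 0 True)) ?s1 (Suc (n * 4))
      (s(N + 2 := replicate n True))" (is "exec _ _ _ ?s2")
  proof -
    have "?s1(N + 1 := [], 0 := ((#) True ^^ n) (?s1 0)) = ?s2"
      using assms by (auto simp: funpow_Cons)
    then show ?thesis using exec_drain[OF updates_Push, of "N + 1" 0 1 True ?s1] assms(1)
      by (simp add: s_def)
  qed
  let ?q = "(n + M - 1) div M"
  have 3: "exec (drain (N + 2) M (Push (N + 3) True)) ?s2 (Suc (?q * (M + 3)))
      (s(N + 3 := replicate ?q True))"
  proof -
    have "?s2(N + 2 := [], N + 3 := ((#) True ^^ ?q) (?s2 (N + 3))) = s(N + 3 := replicate ?q True)"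
      using assms by (auto simp: funpow_Cons)
    then show ?thesis using exec_drain[OF updates_Push, of "N + 2" "N + 3" M True ?s2] assms(1,2)
      by simp
  qed
  have "?q \<le> n" using assms(2) by (rule ceil_div_le)
  then have "?q * (M + 3) \<le> n * (M + 3)" by (rule mult_right_mono) simp
  moreover note exec.Seq[OF 1 exec.Seq[OF 2 3]]
  ultimately show ?thesis
    by (intro exI[of _ "5 * n + 5 + (Suc (n * 4) + Suc (?q * (M + 3)))"])
      (auto simp: count_vars_def algebra_simps)
qed

text \<open>Register \<open>N + 4\<close> is a unary counter: it starts at 2, grows by the bit
  length of the numerator and shrinks by that of the denominator and by the content of
  \<open>N + 3\<close>. Popping an empty stack truncates at 0, so it ends empty exactly if the
  inequality of \<open>small_rat\<close> holds. The first \<open>Pop 0\<close> drops the sign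
  bit.\<close>

definition test_small :: "nat \<Rightarrow> com" where
  "test_small N = Seq (Push (N + 4) True) (Seq (Push (N + 4) True) (Seq (Pop 0)
     (Seq (parse_nat N (Push (N + 4) True)) (Seq (parse_nat N (Pop (N + 4)))
     (Seq (drain (N + 3) 1 (Pop (N + 4)))
     (Branch (N + 4) (Push 0 True) (Push 0 False) (Push 0 False)))))))"

lemma exec_test_small:
  assumes "0 < N" "s 0 = enc_rat q" "s N = []" "s (N + 3) = replicate j True" "s (N + 4) = []"
  shows "\<exists>t s'. t \<le> 10 * length (enc_rat q) + 4 * j + 20 \<and> exec (test_small N) s t s' \<and>
    s' 0 = enc_bool (small_rat j q)"
proof -
  obtain a b where ab: "quotient_of q = (a, b)" by fastforce
  let ?la = "length (bits (nat \<bar>a\<bar>))" and ?lb = "length (bits (nat b))"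
  have enc: "enc_rat q = (a < 0) # enc_nat (nat \<bar>a\<bar>) @ enc_nat (nat b)"
    using ab by (simp add: enc_rat_def)
  have len: "length (enc_nat m) = 2 * length (bits m) + 1" for m
    by (simp add: enc_nat_def length_concat comp_def sum_list_triv)
  define s1 where "s1 = s(0 := enc_nat (nat \<bar>a\<bar>) @ enc_nat (nat b), N + 4 := [True, True])"
  define s2 where "s2 = s(0 := enc_nat (nat b), N + 4 := replicate (?la + 2) True)"
  define s3 where "s3 = s(0 := [], N + 4 := replicate (?la + 2 - ?lb) True)"
  define s4 where "s4 = s(0 := [], N + 3 := [], N + 4 := replicate (?la + 2 - ?lb - j) True)"
  have 1: "exec (Push (N + 4) True) s 1 (s(N + 4 := [True]))"
    "exec (Push (N + 4) True) (s(N + 4 := [True])) 1 (s(N + 4 := [True, True]))"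
    "exec (Pop 0) (s(N + 4 := [True, True])) 1 s1"
    using exec.Push[of "N + 4" True s] exec.Push[of "N + 4" True "s(N + 4 := [True])"]
      exec.Pop[of 0 "s(N + 4 := [True, True])"] assms
    by (simp_all add: s1_def enc fun_upd_twist)
  have 2: "exec (parse_nat N (Push (N + 4) True)) s1 (5 * ?la + 6) s2"
  proof -
    have "s1(0 := enc_nat (nat b), N + 4 := ((#) True ^^ ?la) (s1 (N + 4))) = s2"
      by (auto simp: s1_def s2_def funpow_Cons replicate_add[symmetric] numeral_eq_Suc replicate_app_Cons_same)
    then show ?thesis
      using exec_parse_nat[OF updates_Push, of s1 "nat \<bar>a\<bar>" "enc_nat (nat b)" N "N + 4" True] assms
      by (simp add: s1_def)
  qed
  have 3: "exec (parse_nat N (Pop (N + 4))) s2 (5 * ?lb + 6) s3"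
  proof -
    have "s2(0 := [], N + 4 := (tl ^^ ?lb) (s2 (N + 4))) = s3"
      by (auto simp: s2_def s3_def funpow_tl drop_replicate simp del: replicate_Suc)
    then show ?thesis
      using exec_parse_nat[OF updates_Pop, of s2 "nat b" "[]" N "N + 4"] assms
      by (simp add: s2_def)
  qed
  have 4: "exec (drain (N + 3) 1 (Pop (N + 4))) s3 (Suc (j * 4)) s4"
  proof -
    have "s3(N + 3 := [], N + 4 := (tl ^^ j) (s3 (N + 4))) = s4"
      by (auto simp: s3_def s4_def funpow_tl drop_replicate simp del: replicate_Suc)
    then show ?thesis
      using exec_drain[OF updates_Pop, of "N + 3" "N + 4" 1 s3] assms
      by (simp add: s3_def)
  qed
  have 5: "exec (Branch (N + 4) (Push 0 True) (Push 0 False) (Push 0 False)) s4 (Suc 1)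
      (s4(0 := [small_rat j q]))"
  proof (cases "?la + 2 - ?lb - j")
    case 0
    then have "small_rat j q" using ab by (simp add: small_rat_def)
    moreover have "exec (Branch (N + 4) (Push 0 True) (Push 0 False) (Push 0 False)) s4 (Suc 1)
        (s4(0 := True # s4 0))"
      using 0 by (intro exec.Branch_Nil[OF _ exec.Push]) (simp add: s4_def)
    ultimately show ?thesis by (simp add: s4_def)
  next
    case (Suc m)
    then have "\<not> small_rat j q" using ab by (simp add: small_rat_def)
    moreover have "exec (Branch (N + 4) (Push 0 True) (Push 0 False) (Push 0 False)) s4 (Suc 1)
        (s4(0 := False # s4 0))"
      using Suc by (intro exec.Branch_True[where bs = "replicate m True", OF _ exec.Push])
        (simp add: s4_def)
    ultimately show ?thesis by (simp add: s4_def)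
  qed
  from exec.Seq[OF 1(1) exec.Seq[OF 1(2) exec.Seq[OF 1(3) exec.Seq[OF 2 exec.Seq[OF 3 exec.Seq[OF 4 5]]]]]]
  have "exec (test_small N) s (1 + (1 + (1 + (5 * ?la + 6 + (5 * ?lb + 6 + (Suc (j * 4) + Suc 1))))))
      (s4(0 := [small_rat j q]))"
    by (simp add: test_small_def)
  moreover have "1 + (1 + (1 + (5 * ?la + 6 + (5 * ?lb + 6 + (Suc (j * 4) + Suc 1))))) \<le>
      10 * length (enc_rat q) + 4 * j + 20"
    by (simp add: enc len)
  ultimately show ?thesis
    by (metis enc_bool_def fun_upd_same)
qed

lemma polytime_on_small_rat:
  assumes A: "polytime_on D enc_instance enc_rat A" and "1 \<le> M"
  shows "polytime_on D enc_instance enc_bool (\<lambda>I. small_rat ((fst I + M - 1) div M) (A I))"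
proof -
  from A obtain c p where c: "\<And>I. I \<in> D \<Longrightarrow> \<exists>t s. exec c ((\<lambda>_. [])(0 := enc_instance I)) t s \<and>
      t \<le> poly p (length (enc_instance I)) \<and> s 0 = enc_rat (A I)"
    unfolding polytime_on_def by blast
  obtain N where N: "0 < N" "regs c \<subseteq> {..<N}"
  proof
    show "regs c \<subseteq> {..<Suc (Max (regs c))}"
      using finite_regs[of c] by (auto simp: less_Suc_eq_le)
  qed simp
  let ?c = "Seq (count_vars N M) (Seq c (test_small N))"
  \<comment> \<open>With \<open>l\<close> the input length: counting costs at most 20 + (12 + 4M) l.
    The output of \<open>A\<close> has length at most l + t2, so the test costs at most 20 + 10 (l +
    t2) + 4 l. Adding t2 itself gives these coefficients.\<close>
  let ?P = "[:40, 26 + 4 * M:] + [:11:] * p"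
  show ?thesis unfolding polytime_on_def
  proof (intro exI[of _ ?c] exI[of _ ?P] ballI)
    fix I assume "I \<in> D"
    obtain n H where I: "I = (n, H)" by (cases I)
    let ?l = "length (enc_instance I)"
    let ?q = "(n + M - 1) div M"
    let ?s = "(\<lambda>_. [])(0 := enc_instance I) :: store"
    let ?s1 = "?s(N + 3 := replicate ?q True)"
    have enc: "enc_instance I = replicate n True @ False # concat (sorted_list_of_set (enc_clause ` H))"
      by (simp add: I enc_instance_def)
    then have nl: "n \<le> ?l" by simp
    obtain t1 where t1: "t1 \<le> 12 * n + 4 * M * n + 20" "exec (count_vars N M) ?s t1 ?s1"
      using exec_count_vars[OF N(1) \<open>1 \<le> M\<close> refl, of n] unfolding enc by blast
    from c[OF \<open>I \<in> D\<close>] obtain t2 s2 where t2: "exec c ?s t2 s2" "t2 \<le> poly p ?l"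
      "s2 0 = enc_rat (A I)" by blast
    \<comment> \<open>The result of \<open>A\<close> below \<open>N\<close>, with the counter parked
      in \<open>N + 3\<close> untouched.\<close>
    let ?s2 = "override_on ?s1 s2 {..<N}"
    have "override_on ?s1 ?s {..<N} = ?s1" by (auto simp: override_on_def)
    with exec_frame[OF t2(1) N(2), of ?s1] have c2: "exec c ?s1 t2 ?s2" by simp
    have len: "length (enc_rat (A I)) \<le> ?l + t2"
      using length_exec_le[OF t2(1), of 0] t2(3) by simp
    have "?s2 0 = enc_rat (A I)" "?s2 N = []" "?s2 (N + 3) = replicate ?q True" "?s2 (N + 4) = []"
      using N(1) t2(3) by (auto simp: override_on_def)
    from exec_test_small[OF N(1) this] obtain t3 s3 where t3:
      "t3 \<le> 10 * length (enc_rat (A I)) + 4 * ?q + 20" "exec (test_small N) ?s2 t3 s3"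
      "s3 0 = enc_bool (small_rat ?q (A I))" by blast
    have "?q \<le> n" using \<open>1 \<le> M\<close> by (rule ceil_div_le)
    moreover have "4 * M * n \<le> 4 * M * ?l" using nl by simp
    ultimately have "t1 + (t2 + t3) \<le> 40 + (26 + 4 * M) * ?l + 11 * poly p ?l"
      using t1(1) t2(2) t3(1) len nl unfolding distrib_right by linarith
    then have "t1 + (t2 + t3) \<le> poly ?P ?l" by (simp add: algebra_simps)
    moreover have "exec ?c ?s (t1 + (t2 + t3)) s3"
      by (intro exec.Seq[OF t1(2) exec.Seq[OF c2 t3(2)]])
    ultimately show "\<exists>t s. exec ?c ?s t s \<and> t \<le> poly ?P ?l \<and>
        s 0 = enc_bool (small_rat ((fst I + M - 1) div M) (A I))"
      using t3(3) by (auto simp: I)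
  qed
qed


section \<open>The reduction\<close>

lemma set_pmf_random_hypergraph: "set_pmf (random_hypergraph k m n) \<subseteq> Pow (clauses k n)"
  by (auto simp: random_hypergraph_def)

theorem theorem8p1:
  fixes k :: nat and \<eta> :: real and \<Delta> :: "nat \<Rightarrow> real"
  assumes "1 \<le> k"
    and "0 < \<eta>" and "\<eta> \<le> 1"
    and "\<forall>\<^sub>F n in sequentially. 0 \<le> \<Delta> n * real n \<and> \<Delta> n * real n \<le> 2 ^ k * real n ^ k"
    and "\<exists>A. polytime_on (instances k) enc_instance enc_rat A \<and>
      certifies_bound_whp k (\<lambda>n. \<Delta> n * real n)
        (\<lambda>I. real (card (approx_satisfying_assignments \<eta> I)))
        (\<lambda>n. exp (\<eta> * real n / (10 * real k))) A"
  shows "\<exists>B. polytime_on (instances k) enc_instance enc_bool B \<and>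
      certifies_whp k (\<lambda>n. \<Delta> n * real n)
        (\<lambda>I. approx_satisfying_assignments (\<eta> / 2) I = {}) B"
proof -
  from assms(5) obtain A where A: "polytime_on (instances k) enc_instance enc_rat A"
    and bound: "\<And>I. I \<in> instances k \<Longrightarrow>
      real (card (approx_satisfying_assignments \<eta> I)) \<le> real_of_rat (A I)"
    and lim: "(\<lambda>n. measure_pmf.prob (random_hypergraph k (\<Delta> n * real n) n)
      {H. real_of_rat (A (n, H)) \<le> exp (\<eta> * real n / (10 * real k))}) \<longlonglongrightarrow> 1"
    unfolding certifies_bound_whp_def by blast
  \<comment> \<open>A bound on a cardinality is nonnegative, so \<open>small_rat\<close> may ignore
    the sign.\<close>
  have nonneg: "0 \<le> A I" if "I \<in> instances k" for I
  proof -
    have "0 \<le> real_of_rat (A I)" using bound[OF that] by linarith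
    then show ?thesis by simp
  qed
  define \<alpha> where "\<alpha> = \<eta> / real k"
  have \<alpha>: "0 < \<alpha>" "\<alpha> \<le> 1" "\<alpha> * real k = \<eta>"
    using assms(1-3) by (auto simp: \<alpha>_def divide_le_eq)
  \<comment> \<open>Places \<open>\<alpha> * M\<close> between 3 and 4: the lower bound serves
    soundness, the upper bound completeness.\<close>
  define M where "M = nat \<lceil>3 / \<alpha>\<rceil>"
  have "3 / \<alpha> \<le> real M" by (simp add: M_def real_nat_ceiling_ge)
  then have M3: "3 \<le> \<alpha> * real M" using \<alpha>(1) by (simp add: field_simps)
  have "real M \<le> 3 / \<alpha> + 1" using \<alpha>(1) unfolding M_def by (simp add: of_nat_nat)
  then have "\<alpha> * real M \<le> 3 + \<alpha>" using \<alpha>(1) by (simp add: field_simps)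
  then have M4: "\<alpha> * real M \<le> 4" using \<alpha>(2) by linarith
  have M1: "1 \<le> M" using M3 by (cases M) auto
  define B where "B = (\<lambda>I :: xor_instance. small_rat ((fst I + M - 1) div M) (A I))"
  have sound: "approx_satisfying_assignments (\<eta> / 2) I = {}" if I: "I \<in> instances k" and "B I" for I
  proof (rule ccontr)
    obtain n H where [simp]: "I = (n, H)" by (cases I)
    assume ne: "approx_satisfying_assignments (\<eta> / 2) I \<noteq> {}"
    have n: "1 \<le> n" using I by (simp add: instances_def)
    \<comment> \<open>One less than n / M rounded up. The test with \<open>Suc ?t\<close> guarantees
      a value below \<open>2 ^ ?t\<close>, so \<open>?t\<close> is the number of variables to
      flip.\<close>
    let ?t = "(n - 1) div M"
    have "?t * M \<le> n" by (metis diff_le_self div_times_less_eq_dividend le_trans)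
    then have tM: "real ?t * real M \<le> real n" by (metis of_nat_le_iff of_nat_mult)
    have "2 * real k * real ?t \<le> (\<alpha> * real M) * (real k * real ?t)"
      using M3 mult_right_mono[of 2 "\<alpha> * real M" "real k * real ?t"] by simp
    also have "\<dots> = \<eta> * (real ?t * real M)" by (simp add: \<alpha>(3)[symmetric])
    also have "\<dots> \<le> \<eta> * real n" using tM assms(2) by simp
    finally have "2 ^ ?t \<le> card (approx_satisfying_assignments \<eta> I)"
      using card_approx_satisfying_assignments_ge I assms(1,3) ne by simp
    then have "2 ^ ?t \<le> real (card (approx_satisfying_assignments \<eta> I))"
      by (metis of_nat_le_iff of_nat_numeral of_nat_power)
    also have "\<dots> \<le> real_of_rat (A I)" using bound I by blast
    finally have "2 ^ ?t \<le> real_of_rat (A I)" .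
    moreover have "(n + M - 1) div M = Suc ?t"
      using n M1 div_add_self2[of M "n - 1"] by simp
    then have "small_rat (Suc ?t) (A I)" using \<open>B I\<close> by (simp add: B_def)
    then have "real_of_rat (A I) < 2 ^ ?t" using nonneg[OF I] by (rule small_rat_imp_less)
    ultimately show False by simp
  qed
  \<comment> \<open>The threshold 45 is what
    \<open>3 + \<alpha> * n / 10 \<le> \<alpha> * n / 6\<close> requires. The 3 absorbs the factor 4
    lost to bit lengths, as 4 \<le> exp 3, and the 6 arises from
    \<open>\<alpha> * n / 4 \<le> ?j\<close> and \<open>2 / 3 \<le> ln 2\<close>.\<close>
  have complete: "B (n, H)" if I: "(n, H) \<in> instances k" and n: "45 \<le> \<alpha> * real n"
    and le: "real_of_rat (A (n, H)) \<le> exp (\<eta> * real n / (10 * real k))" for n H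
  proof (rule ccontr)
    let ?j = "(n + M - 1) div M"
    assume "\<not> B (n, H)"
    then have "\<not> small_rat ?j (A (n, H))" by (simp add: B_def)
    moreover have n1: "1 \<le> n" using I by (simp add: instances_def)
    then have j: "?j = Suc ((n - 1) div M)" using M1 div_add_self2[of M "n - 1"] by simp
    then have "1 \<le> ?j" by simp
    ultimately have "2 ^ ?j < 4 * real_of_rat (A (n, H))"
      using nonneg[OF I] by (intro not_small_rat_imp_less)
    also have "\<dots> \<le> 4 * exp (\<alpha> * real n / 10)" using le by (simp add: \<alpha>_def mult.commute)
    also have "\<dots> \<le> exp 3 * exp (\<alpha> * real n / 10)"
      using exp_ge_add_one_self[of 3] by (intro mult_right_mono) auto
    also have "\<dots> = exp (3 + \<alpha> * real n / 10)" by (simp add: exp_add)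
    also have "\<dots> \<le> exp (\<alpha> * real n / 4 * (2 / 3))" using n by simp
    also have "\<dots> \<le> exp (real ?j * ln 2)"
    proof -
      have "n - 1 < M * ?j" unfolding j using M1 dividend_less_times_div[of M "n - 1"] by simp
      then have "n \<le> M * ?j" by linarith
      then have "real n \<le> real M * real ?j" by (metis of_nat_le_iff of_nat_mult)
      then have "\<alpha> * real n \<le> (\<alpha> * real M) * real ?j" using \<alpha>(1) by simp
      also have "\<dots> \<le> 4 * real ?j" using M4 by (intro mult_right_mono) auto
      finally have "\<alpha> * real n / 4 \<le> real ?j" by simp
      then have "\<alpha> * real n / 4 * (2 / 3) \<le> real ?j * ln 2"
        using ln2_ge_two_thirds \<alpha>(1) by (intro mult_mono) auto
      then show ?thesis by simp
    qed
    also have "\<dots> = 2 ^ ?j" by (simp add: exp_of_nat_mult)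
    finally show False by simp
  qed
  have "\<forall>\<^sub>F n in sequentially. 45 / \<alpha> \<le> real n"
    using filterlim_real_sequentially by (simp add: filterlim_at_top)
  then have "\<forall>\<^sub>F n in sequentially.
      measure_pmf.prob (random_hypergraph k (\<Delta> n * real n) n)
        {H. real_of_rat (A (n, H)) \<le> exp (\<eta> * real n / (10 * real k))} \<le>
      measure_pmf.prob (random_hypergraph k (\<Delta> n * real n) n) {H. B (n, H)}"
    using eventually_ge_at_top[of 1]
  proof eventually_elim
    case (elim n)
    then have n: "45 \<le> \<alpha> * real n" using \<alpha>(1) by (simp add: field_simps)
    \<comment> \<open>The guarantee of \<open>A\<close> concerns genuine instances only, so the
      events are compared on the support of the distribution.\<close>
    have "H \<in> {H. B (n, H)}" if "H \<in> set_pmf (random_hypergraph k (\<Delta> n * real n) n)"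
      and "H \<in> {H. real_of_rat (A (n, H)) \<le> exp (\<eta> * real n / (10 * real k))}" for H
    proof -
      have "(n, H) \<in> instances k"
        using that(1) set_pmf_random_hypergraph elim by (fastforce simp: instances_def)
      then show ?thesis using complete n that(2) by simp
    qed
    then show ?case
      by (intro measure_pmf.finite_measure_mono_AE AE_pmfI) auto
  qed
  then have "(\<lambda>n. measure_pmf.prob (random_hypergraph k (\<Delta> n * real n) n) {H. B (n, H)}) \<longlonglongrightarrow> 1"
    \<comment> \<open>Squeezed between the success probability of \<open>A\<close> and 1.\<close>
    by (rule tendsto_sandwich[OF _ _ lim tendsto_const]) (simp add: measure_pmf.prob_le_1)
  moreover have "polytime_on (instances k) enc_instance enc_bool B"
    unfolding B_def using A M1 by (rule polytime_on_small_rat)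
  ultimately show ?thesis
    using sound unfolding certifies_whp_def by blast
qed

end
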